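(* Let $\alpha>-1$, let $n$ be a positive integer, let $\psi$ be an analytic function on $\mathbb{D}$ that is not identically $0$, and let $\varphi$ be a nonconstant analytic self-map of $\mathbb{D}$. Suppose that $D_{\psi,\varphi,n}$ is bounded on $A_\alpha^2$ and that $\varphi(0)=0$. Then $D_{\psi,\varphi,n}$ is normal if and only if $\psi(z)=az^n$ and $\varphi(z)=bz$ for some $a\in\mathbb{C}\setminus\{0\}$ and $b\in\mathbb{D}\setminus\{0\}$. Moreover, in this case $D_{\psi,\varphi,n}$ is $J$-symmetric.
   Context: $\mathbb{D}$ is the open unit disk in $\mathbb{C}$. For $\alpha>-1$, the weighted Bergman space $A_\alpha^2$ is the Hilbert space of analytic functions $f(z)=\sum_{j\ge0}a_jz^j$ on $\mathbb{D}$ with $\|f\|^2=\sum_{j\ge0}|a_j|^2\beta(j)^2<\infty$, where $\beta(j)^2=\frac{j!\,\Gamma(\alpha+2)}{\Gamma(j+\alpha+2)}$, with inner product $\langle\sum a_jz^j,\sum b_jz^j\rangle=\sum a_j\overline{b_j}\beta(j)^2$. The weighted composition--differentiation operator of order $n$ is $D_{\psi,\varphi,n}f=\psi\cdot(f^{(n)}\circ\varphi)$. A conjugation on a complex Hilbert space is an antilinear isometric involution $C$; a bounded operator $T$ is $C$-symmetric if $CT^*C=T$. $J$ is the conjugation $(Jf)(z)=\overline{f(\overline{z})}$. *)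

theory Defs
  imports "HOL-Complex_Analysis.Complex_Analysis"
begin

abbreviation unit_disk :: "complex set" where
  "unit_disk \<equiv> ball 0 1"

abbreviation taylor_coeff :: "(complex \<Rightarrow> complex) \<Rightarrow> nat \<Rightarrow> complex" where
  "taylor_coeff f j \<equiv> fps_nth (fps_expansion f 0) j"

text \<open>The squared norm of the monomial of degree \<open>j\<close>, i.e. \<open>\<beta>(j)\<^sup>2\<close>.\<close>

definition bergman_weight :: "real \<Rightarrow> nat \<Rightarrow> real" where
  "bergman_weight \<alpha> j = fact j * Gamma (\<alpha> + 2) / Gamma (real j + \<alpha> + 2)"

text \<open>
  A function on the disk is represented by its extension by \<open>0\<close> to the whole plane, so that equality
  of elements of the space is equality of HOL functions.
\<close>

definition bergman_space :: "real \<Rightarrow> (complex \<Rightarrow> complex) set" where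
  "bergman_space \<alpha> = {f. f holomorphic_on unit_disk \<and> (\<forall>z. z \<notin> unit_disk \<longrightarrow> f z = 0) \<and>
     summable (\<lambda>j. (cmod (taylor_coeff f j))\<^sup>2 * bergman_weight \<alpha> j)}"

definition bergman_inner :: "real \<Rightarrow> (complex \<Rightarrow> complex) \<Rightarrow> (complex \<Rightarrow> complex) \<Rightarrow> complex" where
  "bergman_inner \<alpha> f g =
     (\<Sum>j. taylor_coeff f j * cnj (taylor_coeff g j) * complex_of_real (bergman_weight \<alpha> j))"

definition bergman_norm :: "real \<Rightarrow> (complex \<Rightarrow> complex) \<Rightarrow> real" where
  "bergman_norm \<alpha> f = sqrt (\<Sum>j. (cmod (taylor_coeff f j))\<^sup>2 * bergman_weight \<alpha> j)"

definition bergman_bounded :: "real \<Rightarrow> ((complex \<Rightarrow> complex) \<Rightarrow> (complex \<Rightarrow> complex)) \<Rightarrow> bool" where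
  "bergman_bounded \<alpha> T \<longleftrightarrow>
     (\<forall>f\<in>bergman_space \<alpha>. T f \<in> bergman_space \<alpha>) \<and>
     (\<forall>f\<in>bergman_space \<alpha>. \<forall>g\<in>bergman_space \<alpha>. T (\<lambda>z. f z + g z) = (\<lambda>z. T f z + T g z)) \<and>
     (\<forall>c. \<forall>f\<in>bergman_space \<alpha>. T (\<lambda>z. c * f z) = (\<lambda>z. c * T f z)) \<and>
     (\<exists>K. \<forall>f\<in>bergman_space \<alpha>. bergman_norm \<alpha> (T f) \<le> K * bergman_norm \<alpha> f)"

text \<open>
  For bounded \<open>T\<close> and \<open>g\<close> in the space, the described function exists and is unique by the Riesz
  representation theorem.
\<close>

definition bergman_adjoint ::
  "real \<Rightarrow> ((complex \<Rightarrow> complex) \<Rightarrow> (complex \<Rightarrow> complex)) \<Rightarrow> (complex \<Rightarrow> complex) \<Rightarrow> (complex \<Rightarrow> complex)" where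
  "bergman_adjoint \<alpha> T g = (THE h. h \<in> bergman_space \<alpha> \<and>
     (\<forall>f\<in>bergman_space \<alpha>. bergman_inner \<alpha> (T f) g = bergman_inner \<alpha> f h))"

definition bergman_normal :: "real \<Rightarrow> ((complex \<Rightarrow> complex) \<Rightarrow> (complex \<Rightarrow> complex)) \<Rightarrow> bool" where
  "bergman_normal \<alpha> T \<longleftrightarrow> bergman_bounded \<alpha> T \<and>
     (\<forall>f\<in>bergman_space \<alpha>. T (bergman_adjoint \<alpha> T f) = bergman_adjoint \<alpha> T (T f))"

definition bergman_conjugation :: "real \<Rightarrow> ((complex \<Rightarrow> complex) \<Rightarrow> (complex \<Rightarrow> complex)) \<Rightarrow> bool" where
  "bergman_conjugation \<alpha> C \<longleftrightarrow>
     (\<forall>f\<in>bergman_space \<alpha>. C f \<in> bergman_space \<alpha>) \<and>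
     (\<forall>f\<in>bergman_space \<alpha>. \<forall>g\<in>bergman_space \<alpha>. C (\<lambda>z. f z + g z) = (\<lambda>z. C f z + C g z)) \<and>
     (\<forall>c. \<forall>f\<in>bergman_space \<alpha>. C (\<lambda>z. c * f z) = (\<lambda>z. cnj c * C f z)) \<and>
     (\<forall>f\<in>bergman_space \<alpha>. bergman_norm \<alpha> (C f) = bergman_norm \<alpha> f) \<and>
     (\<forall>f\<in>bergman_space \<alpha>. C (C f) = f)"

definition bergman_C_symmetric ::
  "real \<Rightarrow> ((complex \<Rightarrow> complex) \<Rightarrow> (complex \<Rightarrow> complex)) \<Rightarrow>
    ((complex \<Rightarrow> complex) \<Rightarrow> (complex \<Rightarrow> complex)) \<Rightarrow> bool" where
  "bergman_C_symmetric \<alpha> C T \<longleftrightarrow> bergman_conjugation \<alpha> C \<and> bergman_bounded \<alpha> T \<and>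
     (\<forall>f\<in>bergman_space \<alpha>. C (bergman_adjoint \<alpha> T (C f)) = T f)"

definition conj_J :: "(complex \<Rightarrow> complex) \<Rightarrow> (complex \<Rightarrow> complex)" where
  "conj_J f = (\<lambda>z. cnj (f (cnj z)))"

definition weighted_comp_diff ::
  "(complex \<Rightarrow> complex) \<Rightarrow> (complex \<Rightarrow> complex) \<Rightarrow> nat \<Rightarrow> (complex \<Rightarrow> complex) \<Rightarrow> (complex \<Rightarrow> complex)" where
  "weighted_comp_diff \<psi> \<phi> n f =
     (\<lambda>z. if z \<in> unit_disk then \<psi> z * (deriv ^^ n) f (\<phi> z) else 0)"

end

theory Submission
  imports Defs "HOL-Real_Asymp.Real_Asymp"
begin

text \<open>
  Since the operator kills the monomials of degree below \<open>n\<close>, normality forces its adjoint to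
  kill them too, so \<open>\<psi>\<close> vanishes at \<open>0\<close> to order at least \<open>n\<close>. As \<open>\<phi>(0) = 0\<close>, the adjoint then
  has \<open>z\<^sup>n\<close> as an eigenvector, and a normal operator shares the eigenvectors of its adjoint; this
  yields \<open>\<psi>(z) = a z\<^sup>n\<close>. With this form of \<open>\<psi>\<close> the monomial of degree \<open>n + 1\<close> is an eigenvector as well,
  which yields \<open>\<phi>(z) = b z\<close>. Conversely, these symbols give an operator that is diagonal on the
  monomials, with adjoint \<open>J T J\<close>; its eigenvalues \<open>a b\<^bsup>j-n\<^esup> j! / (j-n)!\<close> are bounded only if \<open>|b| < 1\<close>.
\<close>

section \<open>Growth of the weights\<close>

lemma bergman_weight_pos:
  assumes "\<alpha> > -1"
  shows "bergman_weight \<alpha> j > 0"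
  using assms by (auto simp: bergman_weight_def intro!: divide_pos_pos mult_pos_pos Gamma_real_pos)

lemma bergman_weight_Suc:
  assumes "\<alpha> > -1"
  shows "bergman_weight \<alpha> (Suc j) = bergman_weight \<alpha> j * (real j + 1) / (real j + \<alpha> + 2)"
proof -
  have "real j + \<alpha> + 2 > 0" using assms by simp
  hence "Gamma ((real j + \<alpha> + 2) + 1) = (real j + \<alpha> + 2) * Gamma (real j + \<alpha> + 2)"
    by (intro Gamma_plus1) (auto elim!: nonpos_Ints_cases)
  moreover have "(real j + \<alpha> + 2) + 1 = real (Suc j) + \<alpha> + 2" by simp
  ultimately show ?thesis
    by (simp add: bergman_weight_def algebra_simps)
qed

text \<open>By the recurrence for the weights, the ratio of consecutive terms without the power of
  \<open>r\<close> tends to 1, so the radius of convergence is 1. For \<open>r = (cmod z)^2\<close>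
  the sum is the reproducing kernel at the point \<open>(z, z)\<close>.\<close>

lemma summable_power_over_bergman_weight:
  assumes "\<alpha> > -1" "0 \<le> r" "r < 1"
  shows "summable (\<lambda>j. r ^ j / bergman_weight \<alpha> j)"
proof -
  have "conv_radius (\<lambda>j. 1 / bergman_weight \<alpha> j) = 1"
  proof (rule conv_radius_ratio_limit_nonzero)
    have "norm (1 / bergman_weight \<alpha> j) / norm (1 / bergman_weight \<alpha> (Suc j)) =
        (real j + 1) / (real j + (\<alpha> + 2))" for j
      using bergman_weight_pos[OF assms(1), of j] assms(1)
      by (simp add: bergman_weight_Suc add.assoc abs_mult abs_divide)
    moreover have "(\<lambda>j. (real j + 1) / (real j + (\<alpha> + 2))) \<longlonglongrightarrow> 1"
      by real_asymp
    ultimately show "(\<lambda>j. norm (1 / bergman_weight \<alpha> j) / norm (1 / bergman_weight \<alpha> (Suc j))) \<longlonglongrightarrow> 1"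
      by simp
  qed auto
  hence "summable (\<lambda>j. 1 / bergman_weight \<alpha> j * r ^ j)"
    using assms by (intro summable_in_conv_radius) auto
  thus ?thesis by simp
qed

section \<open>Taylor coefficients of functions on the disk\<close>

lemma eventually_in_unit_disk: "eventually (\<lambda>z. z \<in> unit_disk) (nhds 0)"
  by (intro eventually_nhds_in_open) auto

lemma taylor_coeff_cong:
  assumes "\<And>z. z \<in> unit_disk \<Longrightarrow> f z = g z"
  shows "taylor_coeff f j = taylor_coeff g j"
proof -
  have "eventually (\<lambda>z. f z = g z) (nhds 0)"
    using eventually_in_unit_disk by eventually_elim (use assms in auto)
  thus ?thesis by (simp only: fps_expansion_cong)
qed

lemma taylor_coeff_sums:
  assumes "f holomorphic_on unit_disk" "z \<in> unit_disk"
  shows "(\<lambda>j. taylor_coeff f j * z ^ j) sums f z"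
  using holomorphic_power_series[OF assms] by (simp add: fps_expansion_def)

lemma taylor_coeff_eqI:
  assumes "\<And>z. z \<in> unit_disk \<Longrightarrow> (\<lambda>j. c j * z ^ j) sums f z"
  shows "taylor_coeff f j = c j"
proof -
  have "f has_fps_expansion Abs_fps c"
    by (rule has_fps_expansionI, rule eventually_mono[OF eventually_in_unit_disk])
       (use assms in auto)
  from fps_expansion_eqI[OF this] show ?thesis by simp
qed

lemma taylor_coeff_add:
  assumes "f holomorphic_on unit_disk" "g holomorphic_on unit_disk"
  shows "taylor_coeff (\<lambda>z. f z + g z) j = taylor_coeff f j + taylor_coeff g j"
  by (rule taylor_coeff_eqI)
     (use sums_add[OF taylor_coeff_sums[OF assms(1)] taylor_coeff_sums[OF assms(2)]] in
       \<open>simp add: algebra_simps\<close>)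

lemma taylor_coeff_cmult:
  assumes "f holomorphic_on unit_disk"
  shows "taylor_coeff (\<lambda>z. c * f z) j = c * taylor_coeff f j"
  by (rule taylor_coeff_eqI)
     (use sums_mult[OF taylor_coeff_sums[OF assms(1)], of _ c] in \<open>simp add: algebra_simps\<close>)

lemma bergman_spaceD:
  assumes "f \<in> bergman_space \<alpha>"
  shows "f holomorphic_on unit_disk" "\<And>z. z \<notin> unit_disk \<Longrightarrow> f z = 0"
    "summable (\<lambda>j. (cmod (taylor_coeff f j))\<^sup>2 * bergman_weight \<alpha> j)"
  using assms by (auto simp: bergman_space_def)

lemma bergman_space_eqI:
  assumes "f \<in> bergman_space \<alpha>" "g \<in> bergman_space \<alpha>"
    and "\<And>j. taylor_coeff f j = taylor_coeff g j"
  shows "f = g"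
proof
  fix z
  show "f z = g z"
  proof (cases "z \<in> unit_disk")
    case True
    have "(\<lambda>j. taylor_coeff f j * z ^ j) sums f z" "(\<lambda>j. taylor_coeff g j * z ^ j) sums g z"
      using taylor_coeff_sums True bergman_spaceD(1) assms(1,2) by auto
    thus ?thesis using assms(3) sums_unique2 by auto
  next
    case False
    thus ?thesis using bergman_spaceD(2)[OF assms(1)] bergman_spaceD(2)[OF assms(2)] by simp
  qed
qed

section \<open>Functions built from coefficient sequences, and the linear structure of the
  space\<close>

definition bergman_of_coeffs :: "(nat \<Rightarrow> complex) \<Rightarrow> complex \<Rightarrow> complex" where
  "bergman_of_coeffs c = (\<lambda>z. if z \<in> unit_disk then (\<Sum>j. c j * z ^ j) else 0)"

text \<open>This identifies the space with a weighted sequence space. The series converges on the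
  disk because \<open>2 * x * y\<close> is at most the sum of the squares of \<open>x\<close> and
  \<open>y\<close>: each term is split as \<open>cmod (c j) * s\<close> times
  \<open>cmod z ^ j / s\<close>, with \<open>s\<close> the square root of the weight, and both
  squares are summable.\<close>

lemma
  assumes "\<alpha> > -1" and c: "summable (\<lambda>j. (cmod (c j))\<^sup>2 * bergman_weight \<alpha> j)"
  shows bergman_of_coeffs_in_space: "bergman_of_coeffs c \<in> bergman_space \<alpha>"
    and taylor_coeff_bergman_of_coeffs: "taylor_coeff (bergman_of_coeffs c) j = c j"
proof -
  have sums: "(\<lambda>j. c j * z ^ j) sums bergman_of_coeffs c z" if z: "z \<in> unit_disk" for z
  proof -
    have "summable (\<lambda>j. c j * z ^ j)"
    proof (rule summable_comparison_test')
      have "(cmod z)\<^sup>2 < 1" using z by (simp add: abs_square_less_1)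
      thus "summable (\<lambda>j. (cmod (c j))\<^sup>2 * bergman_weight \<alpha> j + ((cmod z)\<^sup>2) ^ j / bergman_weight \<alpha> j)"
        by (intro summable_add c summable_power_over_bergman_weight assms) auto
    next
      fix j
      define w where "w = bergman_weight \<alpha> j"
      have w: "w > 0" unfolding w_def by (rule bergman_weight_pos[OF assms(1)])
      define s where "s = sqrt w"
      have s: "s > 0" "w = s\<^sup>2" using w by (auto simp: s_def)
      have "2 * (cmod (c j) * s) * (cmod z ^ j / s) \<le> (cmod (c j) * s)\<^sup>2 + (cmod z ^ j / s)\<^sup>2"
        by (rule sum_squares_bound)
      hence "2 * (cmod (c j) * cmod z ^ j) \<le> (cmod (c j))\<^sup>2 * w + ((cmod z)\<^sup>2) ^ j / w"
        using s by (simp add: power_mult_distrib power_divide flip: power_mult) (simp add: mult.commute)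
      moreover have "0 \<le> cmod (c j) * cmod z ^ j" by simp
      ultimately show "norm (c j * z ^ j) \<le> (cmod (c j))\<^sup>2 * bergman_weight \<alpha> j + ((cmod z)\<^sup>2) ^ j / bergman_weight \<alpha> j"
        unfolding norm_mult norm_power w_def[symmetric] by linarith
    qed
    thus ?thesis using z by (simp add: bergman_of_coeffs_def summable_sums)
  qed
  show coeff: "taylor_coeff (bergman_of_coeffs c) j = c j" for j
    by (rule taylor_coeff_eqI[OF sums])
  have "bergman_of_coeffs c holomorphic_on unit_disk"
    by (rule power_series_holomorphic) (use sums in simp)
  thus "bergman_of_coeffs c \<in> bergman_space \<alpha>"
    using c by (auto simp: bergman_space_def coeff) (simp add: bergman_of_coeffs_def)
qed

lemma bergman_space_cmult:
  assumes "f \<in> bergman_space \<alpha>"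
  shows "(\<lambda>z. c * f z) \<in> bergman_space \<alpha>"
proof -
  note f = bergman_spaceD[OF assms]
  have "summable (\<lambda>j. (cmod c)\<^sup>2 * ((cmod (taylor_coeff f j))\<^sup>2 * bergman_weight \<alpha> j))"
    by (intro summable_mult f)
  thus ?thesis using f
    by (auto simp: bergman_space_def taylor_coeff_cmult norm_mult power_mult_distrib mult_ac
      intro!: holomorphic_intros)
qed

lemma bergman_space_add:
  assumes "\<alpha> > -1" "f \<in> bergman_space \<alpha>" "g \<in> bergman_space \<alpha>"
  shows "(\<lambda>z. f z + g z) \<in> bergman_space \<alpha>"
proof -
  note f = bergman_spaceD[OF assms(2)]
  note g = bergman_spaceD[OF assms(3)]
  have "summable (\<lambda>j. (cmod (taylor_coeff f j + taylor_coeff g j))\<^sup>2 * bergman_weight \<alpha> j)"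
  proof (rule summable_comparison_test')
    show "summable (\<lambda>j. 2 * ((cmod (taylor_coeff f j))\<^sup>2 * bergman_weight \<alpha> j) +
        2 * ((cmod (taylor_coeff g j))\<^sup>2 * bergman_weight \<alpha> j))"
      by (intro summable_add summable_mult f g)
  next
    fix j
    let ?x = "taylor_coeff f j" and ?y = "taylor_coeff g j"
    have "(cmod (?x + ?y))\<^sup>2 \<le> (cmod ?x + cmod ?y)\<^sup>2"
      by (intro power_mono norm_triangle_ineq) auto
    also have "\<dots> \<le> 2 * (cmod ?x)\<^sup>2 + 2 * (cmod ?y)\<^sup>2"
      using sum_squares_bound[of "cmod ?x" "cmod ?y"] by (simp add: power2_sum)
    finally have "(cmod (?x + ?y))\<^sup>2 * bergman_weight \<alpha> j
        \<le> (2 * (cmod ?x)\<^sup>2 + 2 * (cmod ?y)\<^sup>2) * bergman_weight \<alpha> j"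
      by (intro mult_right_mono less_imp_le[OF bergman_weight_pos] assms)
    moreover have "0 \<le> (cmod (?x + ?y))\<^sup>2 * bergman_weight \<alpha> j"
      by (intro mult_nonneg_nonneg less_imp_le[OF bergman_weight_pos] assms) auto
    ultimately show "norm ((cmod (?x + ?y))\<^sup>2 * bergman_weight \<alpha> j) \<le> 2 * ((cmod ?x)\<^sup>2 * bergman_weight \<alpha> j) +
        2 * ((cmod ?y)\<^sup>2 * bergman_weight \<alpha> j)"
      by (simp only: real_norm_def abs_of_nonneg ring_distribs mult.assoc)
  qed
  thus ?thesis using f g
    by (auto simp: bergman_space_def taylor_coeff_add intro!: holomorphic_intros)
qed

section \<open>Monomials as elements of the space\<close>

definition bergman_monomial :: "nat \<Rightarrow> complex \<Rightarrow> complex" where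
  "bergman_monomial m = (\<lambda>z. if z \<in> unit_disk then z ^ m else 0)"

lemma taylor_coeff_power: "taylor_coeff (\<lambda>z. z ^ m) j = (if j = m then 1 else 0)"
proof (rule taylor_coeff_eqI)
  fix z :: complex
  show "(\<lambda>j. (if j = m then 1 else 0) * z ^ j) sums z ^ m"
    using sums_single[of m "\<lambda>j. z ^ j"] by (simp add: if_distrib if_distribR cong: if_cong)
qed

lemma taylor_coeff_bergman_monomial:
  "taylor_coeff (bergman_monomial m) j = (if j = m then 1 else 0)"
  using taylor_coeff_cong[of "bergman_monomial m" "\<lambda>z. z ^ m"] taylor_coeff_power
  by (simp add: bergman_monomial_def)

lemma bergman_monomial_in_space: "bergman_monomial m \<in> bergman_space \<alpha>"
proof -
  have "bergman_monomial m holomorphic_on unit_disk \<longleftrightarrow> (\<lambda>z. z ^ m) holomorphic_on unit_disk"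
    by (intro holomorphic_cong) (auto simp: bergman_monomial_def)
  moreover have "summable (\<lambda>j. (cmod (taylor_coeff (bergman_monomial m) j))\<^sup>2 * bergman_weight \<alpha> j)"
    by (rule summable_finite[of "{m}"]) (auto simp: taylor_coeff_bergman_monomial)
  ultimately show ?thesis
    by (auto simp: bergman_space_def intro!: holomorphic_intros) (auto simp: bergman_monomial_def)
qed

lemma bergman_inner_monomial_right:
  "bergman_inner \<alpha> f (bergman_monomial m) = taylor_coeff f m * bergman_weight \<alpha> m"
  unfolding bergman_inner_def taylor_coeff_bergman_monomial
  by (subst suminf_finite[of "{m}"]) auto

lemma bergman_inner_monomial_left:
  "bergman_inner \<alpha> (bergman_monomial m) f = cnj (taylor_coeff f m) * bergman_weight \<alpha> m"
  unfolding bergman_inner_def taylor_coeff_bergman_monomial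
  by (subst suminf_finite[of "{m}"]) auto

section \<open>Cauchy-Schwarz inequality and sesquilinearity of the inner product\<close>

lemma bergman_norm_nonneg:
  assumes "\<alpha> > -1" "f \<in> bergman_space \<alpha>"
  shows "0 \<le> bergman_norm \<alpha> f"
  unfolding bergman_norm_def
  by (intro real_sqrt_ge_zero suminf_nonneg bergman_spaceD(3)[OF assms(2)] mult_nonneg_nonneg
      less_imp_le[OF bergman_weight_pos] assms) auto

text \<open>Half of the weight, in the sense of its square root, goes to each factor. The finite
  Cauchy-Schwarz inequality for \<open>L2_set\<close> then bounds all partial sums of the absolute
  values by the product of the norms, which gives summability and the inequality at once.\<close>

lemma
  assumes "\<alpha> > -1" "f \<in> bergman_space \<alpha>" "g \<in> bergman_space \<alpha>"
  shows bergman_inner_summable: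
      "summable (\<lambda>j. taylor_coeff f j * cnj (taylor_coeff g j) * complex_of_real (bergman_weight \<alpha> j))"
    and bergman_Cauchy_Schwarz: "cmod (bergman_inner \<alpha> f g) \<le> bergman_norm \<alpha> f * bergman_norm \<alpha> g"
proof -
  define F where "F = (\<lambda>j. taylor_coeff f j * cnj (taylor_coeff g j) * complex_of_real (bergman_weight \<alpha> j))"
  define a where "a = (\<lambda>f j. cmod (taylor_coeff f j) * sqrt (bergman_weight \<alpha> j))"
  have w: "bergman_weight \<alpha> j \<ge> 0" for j
    using bergman_weight_pos[OF assms(1), of j] by simp
  have a2: "(a f j)\<^sup>2 = (cmod (taylor_coeff f j))\<^sup>2 * bergman_weight \<alpha> j" for f j
    using w by (simp add: a_def power_mult_distrib)
  have normF: "norm (F j) = \<bar>a f j\<bar> * \<bar>a g j\<bar>" for j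
    using w[of j] by (simp add: F_def a_def norm_mult abs_mult)
  have L2: "L2_set (a h) A \<le> bergman_norm \<alpha> h" if "finite A" "h \<in> bergman_space \<alpha>" for h A
    unfolding L2_set_def bergman_norm_def a2
    by (intro real_sqrt_le_mono sum_le_suminf that bergman_spaceD(3)) (use w in auto)
  have bound: "(\<Sum>j<N. norm (F j)) \<le> bergman_norm \<alpha> f * bergman_norm \<alpha> g" for N
  proof -
    have "(\<Sum>j<N. norm (F j)) \<le> L2_set (a f) {..<N} * L2_set (a g) {..<N}"
      unfolding normF by (rule L2_set_mult_ineq)
    also have "\<dots> \<le> bergman_norm \<alpha> f * bergman_norm \<alpha> g"
      by (intro mult_mono L2 assms bergman_norm_nonneg) auto
    finally show ?thesis .
  qed
  have summ: "summable (\<lambda>j. norm (F j))"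
    using bound by (intro summableI_nonneg_bounded) auto
  thus "summable (\<lambda>j. taylor_coeff f j * cnj (taylor_coeff g j) * complex_of_real (bergman_weight \<alpha> j))"
    unfolding F_def by (rule summable_norm_cancel)
  have "cmod (bergman_inner \<alpha> f g) \<le> (\<Sum>j. norm (F j))"
    using summable_norm[OF summ] by (simp add: bergman_inner_def F_def)
  also have "\<dots> \<le> bergman_norm \<alpha> f * bergman_norm \<alpha> g"
    by (intro suminf_le_const summ bound)
  finally show "cmod (bergman_inner \<alpha> f g) \<le> bergman_norm \<alpha> f * bergman_norm \<alpha> g" .
qed

lemma bergman_inner_add_left:
  assumes "\<alpha> > -1" "f \<in> bergman_space \<alpha>" "g \<in> bergman_space \<alpha>" "h \<in> bergman_space \<alpha>"
  shows "bergman_inner \<alpha> (\<lambda>z. f z + g z) h = bergman_inner \<alpha> f h + bergman_inner \<alpha> g h"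
  unfolding bergman_inner_def taylor_coeff_add[OF bergman_spaceD(1)[OF assms(2)] bergman_spaceD(1)[OF assms(3)]]
  using suminf_add[OF bergman_inner_summable[OF assms(1,2,4)] bergman_inner_summable[OF assms(1,3,4)]]
  by (simp add: algebra_simps)

lemma bergman_inner_cmult_left:
  assumes "\<alpha> > -1" "f \<in> bergman_space \<alpha>" "h \<in> bergman_space \<alpha>"
  shows "bergman_inner \<alpha> (\<lambda>z. c * f z) h = c * bergman_inner \<alpha> f h"
  unfolding bergman_inner_def taylor_coeff_cmult[OF bergman_spaceD(1)[OF assms(2)]]
  using suminf_mult[OF bergman_inner_summable[OF assms], of c]
  by (simp add: algebra_simps)

lemma bergman_inner_cmult_right:
  assumes "\<alpha> > -1" "f \<in> bergman_space \<alpha>" "h \<in> bergman_space \<alpha>"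
  shows "bergman_inner \<alpha> f (\<lambda>z. c * h z) = cnj c * bergman_inner \<alpha> f h"
  unfolding bergman_inner_def taylor_coeff_cmult[OF bergman_spaceD(1)[OF assms(3)]]
  using suminf_mult[OF bergman_inner_summable[OF assms], of "cnj c"]
  by (simp add: algebra_simps)

lemma bergman_inner_self:
  assumes "f \<in> bergman_space \<alpha>"
  shows "bergman_inner \<alpha> f f = complex_of_real (\<Sum>j. (cmod (taylor_coeff f j))\<^sup>2 * bergman_weight \<alpha> j)"
  unfolding bergman_inner_def suminf_of_real[OF bergman_spaceD(3)[OF assms]]
  by (simp add: complex_norm_square del: of_real_power)

lemma bergman_inner_self_eq_0:
  assumes "\<alpha> > -1" "f \<in> bergman_space \<alpha>" "bergman_inner \<alpha> f f = 0"
  shows "taylor_coeff f j = 0"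
proof -
  have "(\<Sum>j. (cmod (taylor_coeff f j))\<^sup>2 * bergman_weight \<alpha> j) = 0"
    using assms(3) unfolding bergman_inner_self[OF assms(2)] by simp
  hence "(cmod (taylor_coeff f j))\<^sup>2 * bergman_weight \<alpha> j = 0"
    using suminf_eq_zero_iff[OF bergman_spaceD(3)[OF assms(2)]] less_imp_le[OF bergman_weight_pos[OF assms(1)]]
    by auto
  thus ?thesis using bergman_weight_pos[OF assms(1), of j] by auto
qed

section \<open>Riesz representation and adjoints\<close>

text \<open>The values of \<open>t\<close> on the monomials force the coefficients of the
  representing function. Boundedness of \<open>t\<close> makes these coefficients square summable
  for the weights, and density of the polynomials extends the identity to the whole space.\<close>

lemma bergman_riesz:
  assumes \<alpha>: "\<alpha> > -1"
    and add: "\<And>f g. f \<in> bergman_space \<alpha> \<Longrightarrow> g \<in> bergman_space \<alpha> \<Longrightarrow> t (\<lambda>z. f z + g z) = t f + t g"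
    and cmult: "\<And>c f. f \<in> bergman_space \<alpha> \<Longrightarrow> t (\<lambda>z. c * f z) = c * t f"
    and bound: "\<And>f. f \<in> bergman_space \<alpha> \<Longrightarrow> cmod (t f) \<le> M * bergman_norm \<alpha> f"
  shows "\<exists>h\<in>bergman_space \<alpha>. \<forall>f\<in>bergman_space \<alpha>. t f = bergman_inner \<alpha> f h"
proof -
  define w where "w = bergman_weight \<alpha>"
  have w: "w j > 0" for j unfolding w_def by (rule bergman_weight_pos[OF \<alpha>])
  \<comment> \<open>Truncations are finite combinations of monomials, so linearity alone computes
    \<open>t\<close> on them.\<close>
  define trunc where "trunc = (\<lambda>c N. bergman_of_coeffs (\<lambda>j. if j < N then c j else (0::complex)))"
  have summ: "summable (\<lambda>j. (cmod (if j < N then c j else 0))\<^sup>2 * bergman_weight \<alpha> j)" for c N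
    by (rule summable_finite[of "{..<N}"]) auto
  have trunc_in: "trunc c N \<in> bergman_space \<alpha>" for c N
    unfolding trunc_def by (rule bergman_of_coeffs_in_space[OF \<alpha> summ])
  have coeff_trunc: "taylor_coeff (trunc c N) j = (if j < N then c j else 0)" for c N j
    unfolding trunc_def by (rule taylor_coeff_bergman_of_coeffs[OF \<alpha> summ])
  have t_trunc: "t (trunc c N) = (\<Sum>j<N. c j * t (bergman_monomial j))" for c N
  proof (induction N)
    case 0
    \<comment> \<open>The zero function is written as a scalar multiple of a monomial so that
      homogeneity gives the value 0.\<close>
    have "trunc c 0 = (\<lambda>z. 0 * bergman_monomial 0 z)"
      by (simp add: trunc_def bergman_of_coeffs_def fun_eq_iff)
    thus ?case using cmult[OF bergman_monomial_in_space, of 0 0] by simp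
  next
    case (Suc N)
    let ?e = "\<lambda>z. c N * bergman_monomial N z"
    have e: "?e \<in> bergman_space \<alpha>"
      by (intro bergman_space_cmult bergman_monomial_in_space)
    have "trunc c (Suc N) = (\<lambda>z. trunc c N z + ?e z)"
    proof (rule bergman_space_eqI[OF trunc_in bergman_space_add[OF \<alpha> trunc_in e]])
      show "taylor_coeff (trunc c (Suc N)) j = taylor_coeff (\<lambda>z. trunc c N z + ?e z) j" for j
        by (auto simp: taylor_coeff_add[OF bergman_spaceD(1)[OF trunc_in] bergman_spaceD(1)[OF e]]
            taylor_coeff_cmult[OF bergman_spaceD(1)[OF bergman_monomial_in_space]]
            taylor_coeff_bergman_monomial coeff_trunc less_Suc_eq)
    qed
    thus ?case
      using add[OF trunc_in e] cmult[OF bergman_monomial_in_space] Suc by simp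
  qed
  \<comment> \<open>The only possible choice, since \<open>t (bergman_monomial j)\<close> must equal
    the inner product of the monomial with the representing function, that is,
    \<open>cnj (h j) * w j\<close>.\<close>
  define h where "h = (\<lambda>j. cnj (t (bergman_monomial j)) / complex_of_real (w j))"
  have t_mono: "t (bergman_monomial j) = cnj (h j) * w j" for j
    using w[of j] by (simp add: h_def)
  \<comment> \<open>Testing \<open>t\<close> on the truncation of \<open>h\<close> itself: the value
    is \<open>S\<close> and the norm is \<open>sqrt S\<close>, so the bound reads
    \<open>S \<le> M * sqrt S\<close>. Cancelling \<open>sqrt S\<close> requires the case
    \<open>S = 0\<close> to be separated.\<close>
  have "(\<Sum>j<N. (cmod (h j))\<^sup>2 * w j) \<le> M\<^sup>2" for N
  proof -
    define S where "S = (\<Sum>j<N. (cmod (h j))\<^sup>2 * w j)"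
    have S0: "S \<ge> 0" unfolding S_def by (intro sum_nonneg mult_nonneg_nonneg less_imp_le[OF w]) auto
    have "t (trunc h N) = complex_of_real S"
      unfolding t_trunc S_def t_mono by (simp add: complex_norm_square mult.assoc del: of_real_power)
    moreover have "bergman_norm \<alpha> (trunc h N) = sqrt S"
      unfolding bergman_norm_def S_def coeff_trunc w_def
      by (subst suminf_finite[of "{..<N}"]) auto
    ultimately have "S \<le> M * sqrt S"
      using bound[OF trunc_in, of h N] S0 by simp
    hence "sqrt S * sqrt S \<le> M * sqrt S" using S0 by simp
    hence "sqrt S \<le> M \<or> S = 0"
      using S0 mult_right_le_imp_le[of "sqrt S" "sqrt S" M] by (cases "S = 0") auto
    thus "S \<le> M\<^sup>2"
      using S0 by (auto dest!: sqrt_le_D)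
  qed
  hence hs: "summable (\<lambda>j. (cmod (h j))\<^sup>2 * bergman_weight \<alpha> j)"
    using w by (intro summableI_nonneg_bounded) (auto simp: w_def less_imp_le)
  define H where "H = bergman_of_coeffs h"
  have H: "H \<in> bergman_space \<alpha>" "taylor_coeff H j = h j" for j
    unfolding H_def by (auto simp: bergman_of_coeffs_in_space[OF \<alpha> hs] taylor_coeff_bergman_of_coeffs[OF \<alpha> hs])
  have "t f = bergman_inner \<alpha> f H" if f: "f \<in> bergman_space \<alpha>" for f
  proof -
    define c where "c = taylor_coeff f"
    define P where "P = (\<lambda>j. (cmod (c j))\<^sup>2 * w j)"
    have P: "summable P" using bergman_spaceD(3)[OF f] by (simp add: P_def w_def c_def)
    have "(\<lambda>N. t (trunc c N)) \<longlonglongrightarrow> bergman_inner \<alpha> f H"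
      using summable_LIMSEQ[OF bergman_inner_summable[OF \<alpha> f H(1)]]
      by (simp add: t_trunc t_mono bergman_inner_def H(2) c_def w_def mult.assoc)
    moreover have "(\<lambda>N. t (trunc c N)) \<longlonglongrightarrow> t f"
    proof -
      \<comment> \<open>The remainder after \<open>N\<close> terms; its squared norm is a tail of
        the convergent series \<open>P\<close>, so it tends to 0 and \<open>t\<close> follows by
        boundedness.\<close>
      define d where "d = (\<lambda>N z. f z + (-1) * trunc c N z)"
      have d: "d N \<in> bergman_space \<alpha>" for N
        unfolding d_def by (intro bergman_space_add bergman_space_cmult trunc_in f \<alpha>)
      have td: "t (d N) = t f - t (trunc c N)" for N
        unfolding d_def add[OF f bergman_space_cmult[OF trunc_in]] cmult[OF trunc_in] by simp
      have cd: "taylor_coeff (d N) j = (if j < N then 0 else c j)" for N j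
        unfolding d_def taylor_coeff_add[OF bergman_spaceD(1)[OF f] bergman_spaceD(1)[OF bergman_space_cmult[OF trunc_in]]]
          taylor_coeff_cmult[OF bergman_spaceD(1)[OF trunc_in]] coeff_trunc c_def by simp
      have nd: "bergman_norm \<alpha> (d N) = sqrt (suminf P - (\<Sum>j<N. P j))" for N
      proof -
        have "(\<lambda>j. P j - (if j \<in> {..<N} then P j else 0)) sums (suminf P - (\<Sum>j<N. P j))"
          by (intro sums_diff sums_If_finite_set summable_sums P) auto
        also have "(\<lambda>j. P j - (if j \<in> {..<N} then P j else 0)) =
            (\<lambda>j. (cmod (taylor_coeff (d N) j))\<^sup>2 * bergman_weight \<alpha> j)"
          by (auto simp: cd P_def w_def)
        finally show ?thesis unfolding bergman_norm_def by (simp add: sums_iff)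
      qed
      have "(\<lambda>N. sqrt (suminf P - (\<Sum>j<N. P j))) \<longlonglongrightarrow> sqrt (suminf P - suminf P)"
        by (intro tendsto_intros summable_LIMSEQ P)
      hence "(\<lambda>N. M * bergman_norm \<alpha> (d N)) \<longlonglongrightarrow> 0"
        unfolding nd using tendsto_mult_right_zero by auto
      hence "(\<lambda>N. t (d N)) \<longlonglongrightarrow> 0"
        by (rule Lim_null_comparison[rotated]) (use bound[OF d] in auto)
      hence "(\<lambda>N. t f - t (d N)) \<longlonglongrightarrow> t f - 0"
        by (intro tendsto_intros)
      thus ?thesis by (simp add: td)
    qed
    ultimately show ?thesis by (rule LIMSEQ_unique[symmetric])
  qed
  thus ?thesis using H(1) by blast
qed

lemma bergman_inner_right_cancel:
  assumes "\<alpha> > -1" "h \<in> bergman_space \<alpha>" "h' \<in> bergman_space \<alpha>"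
    and "\<And>f. f \<in> bergman_space \<alpha> \<Longrightarrow> bergman_inner \<alpha> f h = bergman_inner \<alpha> f h'"
  shows "h = h'"
proof (rule bergman_space_eqI[OF assms(2,3)])
  fix j
  show "taylor_coeff h j = taylor_coeff h' j"
    using assms(4)[OF bergman_monomial_in_space[of j \<alpha>]] bergman_weight_pos[OF assms(1), of j]
    by (simp add: bergman_inner_monomial_left)
qed

text \<open>The definite description is resolved by uniqueness: a function in the space is
  determined by its inner products with the monomials.\<close>

lemma bergman_adjoint_eqI:
  assumes "\<alpha> > -1" "h \<in> bergman_space \<alpha>"
    and "\<And>f. f \<in> bergman_space \<alpha> \<Longrightarrow> bergman_inner \<alpha> (T f) g = bergman_inner \<alpha> f h"
  shows "bergman_adjoint \<alpha> T g = h"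
  unfolding bergman_adjoint_def
  by (rule the_equality) (use assms bergman_inner_right_cancel[OF assms(1)] in auto)

text \<open>For fixed \<open>g\<close>, the functional sending \<open>f\<close> to
  \<open>bergman_inner \<alpha> (T f) g\<close> is linear and, by Cauchy-Schwarz, bounded by
  \<open>K\<close> times the norm of \<open>g\<close>; its Riesz representative is the adjoint at
  \<open>g\<close>.\<close>

lemma
  assumes "\<alpha> > -1" "bergman_bounded \<alpha> T" "g \<in> bergman_space \<alpha>"
  shows bergman_adjoint_in_space: "bergman_adjoint \<alpha> T g \<in> bergman_space \<alpha>"
    and bergman_inner_adjoint: "\<And>f. f \<in> bergman_space \<alpha> \<Longrightarrow>
      bergman_inner \<alpha> (T f) g = bergman_inner \<alpha> f (bergman_adjoint \<alpha> T g)"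
proof -
  note T = assms(2)[unfolded bergman_bounded_def]
  obtain K where K: "\<And>f. f \<in> bergman_space \<alpha> \<Longrightarrow> bergman_norm \<alpha> (T f) \<le> K * bergman_norm \<alpha> f"
    using T by blast
  have "\<exists>h\<in>bergman_space \<alpha>. \<forall>f\<in>bergman_space \<alpha>. bergman_inner \<alpha> (T f) g = bergman_inner \<alpha> f h"
  proof (rule bergman_riesz[OF assms(1), where M = "K * bergman_norm \<alpha> g"])
    fix f assume f: "f \<in> bergman_space \<alpha>"
    have "cmod (bergman_inner \<alpha> (T f) g) \<le> bergman_norm \<alpha> (T f) * bergman_norm \<alpha> g"
      using T f by (intro bergman_Cauchy_Schwarz assms) auto
    also have "\<dots> \<le> K * bergman_norm \<alpha> f * bergman_norm \<alpha> g"
      by (intro mult_right_mono K f bergman_norm_nonneg assms)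
    finally show "cmod (bergman_inner \<alpha> (T f) g) \<le> K * bergman_norm \<alpha> g * bergman_norm \<alpha> f"
      by (simp add: mult_ac)
  qed (use T assms bergman_inner_add_left bergman_inner_cmult_left in auto)
  then obtain h where h: "h \<in> bergman_space \<alpha>"
      "\<And>f. f \<in> bergman_space \<alpha> \<Longrightarrow> bergman_inner \<alpha> (T f) g = bergman_inner \<alpha> f h"
    by blast
  have "bergman_adjoint \<alpha> T g = h"
    by (rule bergman_adjoint_eqI[OF assms(1) h])
  thus "bergman_adjoint \<alpha> T g \<in> bergman_space \<alpha>" and "\<And>f. f \<in> bergman_space \<alpha> \<Longrightarrow>
      bergman_inner \<alpha> (T f) g = bergman_inner \<alpha> f (bergman_adjoint \<alpha> T g)"
    using h by auto
qed

section \<open>Kernels and eigenvectors of normal operators\<close>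

text \<open>Let \<open>h\<close> be the adjoint applied to \<open>g\<close>. Normality gives
  \<open>T h = 0\<close>, because the adjoint maps \<open>T g = 0\<close> to 0. The squared norm of
  \<open>h\<close> is the inner product of \<open>T h\<close> with \<open>g\<close>, so
  \<open>h = 0\<close> and the range of \<open>T\<close> is orthogonal to \<open>g\<close>.\<close>

lemma bergman_normal_kernel:
  assumes "\<alpha> > -1" "bergman_normal \<alpha> T" "g \<in> bergman_space \<alpha>" "T g = (\<lambda>z. 0)" "f \<in> bergman_space \<alpha>"
  shows "bergman_inner \<alpha> (T f) g = 0"
proof -
  have T: "bergman_bounded \<alpha> T" "T (bergman_adjoint \<alpha> T g) = bergman_adjoint \<alpha> T (T g)"
    using assms(2,3) by (auto simp: bergman_normal_def)
  define h where "h = bergman_adjoint \<alpha> T g"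
  have h: "h \<in> bergman_space \<alpha>"
    unfolding h_def by (rule bergman_adjoint_in_space[OF assms(1) T(1) assms(3)])
  have zero: "(\<lambda>z. 0) \<in> bergman_space \<alpha>"
    using bergman_space_cmult[OF bergman_monomial_in_space, of 0] by simp
  have coeff0: "taylor_coeff (\<lambda>z. 0) j = 0" for j
    by (rule taylor_coeff_eqI) simp
  have "bergman_adjoint \<alpha> T (\<lambda>z. 0) = (\<lambda>z. 0)"
    by (rule bergman_adjoint_eqI[OF assms(1) zero]) (simp add: bergman_inner_def coeff0)
  hence "T h = (\<lambda>z. 0)"
    using T(2) assms(4) by (simp add: h_def)
  moreover have "bergman_inner \<alpha> h h = bergman_inner \<alpha> (T h) g"
    unfolding h_def by (rule bergman_inner_adjoint[OF assms(1) T(1) assms(3) h[unfolded h_def], symmetric])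
  ultimately have "bergman_inner \<alpha> h h = 0"
    by (simp add: bergman_inner_def coeff0)
  hence "taylor_coeff h j = 0" for j
    by (rule bergman_inner_self_eq_0[OF assms(1) h])
  thus ?thesis
    unfolding bergman_inner_adjoint[OF assms(1) T(1) assms(3,5)] h_def[symmetric]
    by (simp add: bergman_inner_def)
qed

text \<open>The hypothesis says that the monomial is an eigenvector of the adjoint.\<close>

lemma bergman_normal_eigen_monomial:
  assumes "\<alpha> > -1" "bergman_normal \<alpha> T"
    and eigen: "\<And>f. f \<in> bergman_space \<alpha> \<Longrightarrow> taylor_coeff (T f) m = \<mu> * taylor_coeff f m"
  shows "T (bergman_monomial m) = (\<lambda>z. \<mu> * bergman_monomial m z)"
proof -
  let ?e = "bergman_monomial m"
  have T: "bergman_bounded \<alpha> T"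
    "T (bergman_adjoint \<alpha> T ?e) = bergman_adjoint \<alpha> T (T ?e)"
    using assms(2) bergman_monomial_in_space by (auto simp: bergman_normal_def)
  have e: "?e \<in> bergman_space \<alpha>" by (rule bergman_monomial_in_space)
  have Te: "T ?e \<in> bergman_space \<alpha>" using T(1) e by (auto simp: bergman_bounded_def)
  define d where "d = taylor_coeff (T ?e)"
  have dm: "d m = \<mu>"
    using eigen[OF e] by (simp add: d_def taylor_coeff_bergman_monomial)
  \<comment> \<open>The inner product of \<open>T f\<close> with the monomial only sees the
    coefficient of index \<open>m\<close>, which \<open>eigen\<close> controls.\<close>
  have adj: "bergman_adjoint \<alpha> T ?e = (\<lambda>z. cnj \<mu> * ?e z)"
    by (rule bergman_adjoint_eqI[OF assms(1) bergman_space_cmult[OF e]])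
       (simp add: bergman_inner_cmult_right[OF assms(1) _ e] bergman_inner_monomial_right eigen)
  \<comment> \<open>The squared norm of \<open>T ?e\<close> is computed by exchanging
    \<open>T\<close> with its adjoint, which acts on \<open>?e\<close> as the scalar
    \<open>cnj \<mu>\<close>.\<close>
  have "bergman_inner \<alpha> (T ?e) (T ?e) = bergman_inner \<alpha> ?e (bergman_adjoint \<alpha> T (T ?e))"
    by (rule bergman_inner_adjoint[OF assms(1) T(1) Te e])
  also have "bergman_adjoint \<alpha> T (T ?e) = T (\<lambda>z. cnj \<mu> * ?e z)"
    using T(2) adj by simp
  also have "\<dots> = (\<lambda>z. cnj \<mu> * T ?e z)"
    using T(1) e by (auto simp: bergman_bounded_def)
  also have "bergman_inner \<alpha> ?e \<dots> = \<mu> * cnj \<mu> * bergman_weight \<alpha> m"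
    using dm by (simp add: bergman_inner_monomial_left taylor_coeff_cmult[OF bergman_spaceD(1)[OF Te]] d_def)
  also have "\<dots> = complex_of_real ((cmod \<mu>)\<^sup>2 * bergman_weight \<alpha> m)"
    by (simp add: complex_norm_square del: of_real_power)
  finally have total: "(\<Sum>j. (cmod (d j))\<^sup>2 * bergman_weight \<alpha> j) = (cmod (d m))\<^sup>2 * bergman_weight \<alpha> m"
    unfolding bergman_inner_self[OF Te] of_real_eq_iff d_def[symmetric] dm .
  \<comment> \<open>The coefficient of index \<open>m\<close> already accounts for the whole squared
    norm of \<open>T ?e\<close>, which leaves nothing for any other index.\<close>
  have "d j = 0" if "j \<noteq> m" for j
  proof -
    have "(\<Sum>j\<in>{m,j}. (cmod (d j))\<^sup>2 * bergman_weight \<alpha> j) \<le> (\<Sum>j. (cmod (d j))\<^sup>2 * bergman_weight \<alpha> j)"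
      using less_imp_le[OF bergman_weight_pos[OF assms(1)]] bergman_spaceD(3)[OF Te]
      by (intro sum_le_suminf) (auto simp: d_def)
    hence "(cmod (d j))\<^sup>2 * bergman_weight \<alpha> j \<le> 0"
      using that unfolding total by simp
    thus ?thesis
      using bergman_weight_pos[OF assms(1), of j] by (simp add: mult_le_0_iff)
  qed
  hence "taylor_coeff (T ?e) j = taylor_coeff (\<lambda>z. \<mu> * ?e z) j" for j
    using dm by (simp add: taylor_coeff_cmult[OF bergman_spaceD(1)[OF e]] taylor_coeff_bergman_monomial d_def)
  thus ?thesis
    by (rule bergman_space_eqI[OF Te bergman_space_cmult[OF e]])
qed

section \<open>Action of the operator on power series and monomials\<close>

lemma taylor_coeff_higher_deriv:
  "taylor_coeff ((deriv ^^ n) f) i = fact (i + n) / fact i * taylor_coeff f (i + n)"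
  by (simp add: fps_expansion_def funpow_add)

text \<open>Turns coefficients of the image into formal power series algebra. The condition
  \<open>\<phi> 0 = 0\<close> is what makes the formal composition agree with the analytic one at
  0.\<close>

lemma fps_expansion_weighted_comp_diff:
  assumes "\<psi> holomorphic_on unit_disk" "\<phi> holomorphic_on unit_disk" "\<phi> 0 = 0"
    and "f holomorphic_on unit_disk"
  shows "fps_expansion (weighted_comp_diff \<psi> \<phi> n f) 0 =
    fps_expansion \<psi> 0 * fps_compose (fps_expansion ((deriv ^^ n) f) 0) (fps_expansion \<phi> 0)"
proof -
  have "\<psi> has_fps_expansion fps_expansion \<psi> 0" "\<phi> has_fps_expansion fps_expansion \<phi> 0"
    using assms by (auto intro!: has_fps_expansion_fps_expansion[of unit_disk])
  moreover have "(deriv ^^ n) f has_fps_expansion fps_expansion ((deriv ^^ n) f) 0"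
    using assms by (auto intro!: has_fps_expansion_fps_expansion[of unit_disk] holomorphic_higher_deriv)
  moreover have "fps_nth (fps_expansion \<phi> 0) 0 = 0"
    using assms by (simp add: fps_expansion_def)
  ultimately have "(\<lambda>z. \<psi> z * ((deriv ^^ n) f \<circ> \<phi>) z) has_fps_expansion
      fps_expansion \<psi> 0 * fps_compose (fps_expansion ((deriv ^^ n) f) 0) (fps_expansion \<phi> 0)"
    by (intro has_fps_expansion_mult has_fps_expansion_compose)
  from fps_expansion_eqI[OF this] show ?thesis
    using fps_expansion_cong[of "weighted_comp_diff \<psi> \<phi> n f" "\<lambda>z. \<psi> z * ((deriv ^^ n) f \<circ> \<phi>) z" 0]
      eventually_mono[OF eventually_in_unit_disk]
    by (simp add: weighted_comp_diff_def)
qed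

text \<open>Since \<open>\<phi> z\<close> lies in the open disk, the cut-off monomial is an honest
  power near it. The Pochhammer factor is \<open>m! / (m - n)!\<close> for \<open>n \<le> m\<close>;
  for \<open>m < n\<close> the truncated difference \<open>Suc m - n\<close> is 0, and so is the
  factor.\<close>

lemma weighted_comp_diff_monomial:
  assumes "\<phi> ` unit_disk \<subseteq> unit_disk" "z \<in> unit_disk"
  shows "weighted_comp_diff \<psi> \<phi> n (bergman_monomial m) z =
    \<psi> z * (pochhammer (of_nat (Suc m - n)) n * \<phi> z ^ (m - n))"
proof -
  have "\<phi> z \<in> unit_disk" using assms by blast
  hence "eventually (\<lambda>w. w \<in> unit_disk) (nhds (\<phi> z))"
    by (intro eventually_nhds_in_open) auto
  hence "eventually (\<lambda>w. bergman_monomial m w = (w - 0) ^ m) (nhds (\<phi> z))"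
    by eventually_elim (simp add: bergman_monomial_def)
  hence "(deriv ^^ n) (bergman_monomial m) (\<phi> z) = (deriv ^^ n) (\<lambda>w. (w - 0) ^ m) (\<phi> z)"
    by (intro higher_deriv_cong_ev) auto
  also have "\<dots> = pochhammer (of_nat (Suc m - n)) n * (\<phi> z - 0) ^ (m - n)"
    by (rule higher_deriv_power)
  finally show ?thesis using assms(2) by (simp add: weighted_comp_diff_def)
qed

text \<open>Differentiation lowers the degree by \<open>n\<close>, substituting \<open>b * z\<close>
  multiplies the coefficient of degree \<open>j - n\<close> by \<open>b ^ (j - n)\<close>, and the
  factor \<open>a * z ^ n\<close> restores the degree.\<close>

lemma taylor_coeff_weighted_comp_diff_diagonal:
  assumes "\<And>z. z \<in> unit_disk \<Longrightarrow> \<psi> z = a * z ^ n" "\<And>z. z \<in> unit_disk \<Longrightarrow> \<phi> z = b * z"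
    and f: "f holomorphic_on unit_disk"
  shows "taylor_coeff (weighted_comp_diff \<psi> \<phi> n f) j =
    (if j < n then 0 else a * b ^ (j - n) * (fact j / fact (j - n))) * taylor_coeff f j"
proof -
  have psi: "fps_expansion \<psi> 0 = fps_const a * fps_X ^ n"
  proof (rule fps_ext)
    fix k
    show "taylor_coeff \<psi> k = fps_nth (fps_const a * fps_X ^ n) k"
      using taylor_coeff_cong[OF assms(1)]
        taylor_coeff_cmult[of "\<lambda>z. z ^ n" a k] taylor_coeff_power[of n k]
      by (simp add: holomorphic_intros)
  qed
  have phi: "fps_expansion \<phi> 0 = fps_const b * fps_X"
  proof (rule fps_ext)
    fix k
    show "taylor_coeff \<phi> k = fps_nth (fps_const b * fps_X) k"
      using taylor_coeff_cong[OF assms(2)]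
        taylor_coeff_cmult[of "\<lambda>z. z" b k] taylor_coeff_power[of 1 k]
      by (simp add: holomorphic_intros)
  qed
  have "\<psi> holomorphic_on unit_disk \<longleftrightarrow> (\<lambda>z. a * z ^ n) holomorphic_on unit_disk"
    "\<phi> holomorphic_on unit_disk \<longleftrightarrow> (\<lambda>z. b * z) holomorphic_on unit_disk"
    by (intro holomorphic_cong refl assms; simp)+
  hence hol: "\<psi> holomorphic_on unit_disk" "\<phi> holomorphic_on unit_disk"
    by (auto intro!: holomorphic_intros)
  have "\<phi> 0 = 0" using assms(2)[of 0] by simp
  from fps_expansion_weighted_comp_diff[OF hol this f, of n] show ?thesis
    by (auto simp: psi phi fps_compose_linear taylor_coeff_higher_deriv mult.assoc
        fps_X_power_mult_nth)
qed

section \<open>The conjugation \<open>conj_J\<close> and operators diagonal on the monomials\<close>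

lemma
  assumes "f \<in> bergman_space \<alpha>"
  shows conj_J_in_space: "conj_J f \<in> bergman_space \<alpha>"
    and taylor_coeff_conj_J: "taylor_coeff (conj_J f) j = cnj (taylor_coeff f j)"
proof -
  note f = bergman_spaceD[OF assms]
  have sums: "(\<lambda>j. cnj (taylor_coeff f j) * z ^ j) sums conj_J f z" if "z \<in> unit_disk" for z
  proof -
    have "(\<lambda>j. taylor_coeff f j * cnj z ^ j) sums f (cnj z)"
      using that by (intro taylor_coeff_sums f) auto
    hence "(\<lambda>j. cnj (taylor_coeff f j * cnj z ^ j)) sums cnj (f (cnj z))"
      by (simp only: sums_cnj)
    thus ?thesis by (simp add: conj_J_def)
  qed
  show coeff: "taylor_coeff (conj_J f) j = cnj (taylor_coeff f j)" for j
    by (rule taylor_coeff_eqI[OF sums])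
  have "conj_J f holomorphic_on unit_disk"
    by (rule power_series_holomorphic) (use sums in simp)
  thus "conj_J f \<in> bergman_space \<alpha>"
    using f by (auto simp: bergman_space_def coeff) (simp add: conj_J_def)
qed

lemma bergman_conjugation_conj_J: "bergman_conjugation \<alpha> conj_J"
  unfolding bergman_conjugation_def
proof (intro conjI ballI allI)
  show "bergman_norm \<alpha> (conj_J f) = bergman_norm \<alpha> f" if "f \<in> bergman_space \<alpha>" for f
    unfolding bergman_norm_def taylor_coeff_conj_J[OF that] by simp
qed (simp_all add: conj_J_in_space, simp_all add: conj_J_def)

text \<open>The operator \<open>conj_J\<close> composed with \<open>T\<close> and
  \<open>conj_J\<close> is diagonal with the conjugate eigenvalues, hence is the adjoint. Diagonal
  operators commute, which gives normality, and \<open>conj_J\<close> is an involution, which gives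
  symmetry.\<close>

lemma
  assumes \<alpha>: "\<alpha> > -1" and T: "bergman_bounded \<alpha> T"
    and diag: "\<And>f j. f \<in> bergman_space \<alpha> \<Longrightarrow> taylor_coeff (T f) j = \<mu> j * taylor_coeff f j"
  shows bergman_normal_diagonal: "bergman_normal \<alpha> T"
    and bergman_C_symmetric_diagonal: "bergman_C_symmetric \<alpha> conj_J T"
proof -
  have T_in: "T f \<in> bergman_space \<alpha>" if "f \<in> bergman_space \<alpha>" for f
    using T that by (auto simp: bergman_bounded_def)
  have J: "conj_J f \<in> bergman_space \<alpha>" "taylor_coeff (conj_J f) j = cnj (taylor_coeff f j)"
    if "f \<in> bergman_space \<alpha>" for f j
    using conj_J_in_space[OF that] taylor_coeff_conj_J[OF that] by auto
  have adj: "bergman_adjoint \<alpha> T g = conj_J (T (conj_J g))" if "g \<in> bergman_space \<alpha>" for g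
    by (rule bergman_adjoint_eqI[OF \<alpha>])
       (simp_all add: bergman_inner_def J T_in diag that mult_ac)
  have "T (bergman_adjoint \<alpha> T f) = bergman_adjoint \<alpha> T (T f)" if "f \<in> bergman_space \<alpha>" for f
    by (rule bergman_space_eqI[of _ \<alpha>])
       (simp_all add: adj J T_in diag that)
  thus "bergman_normal \<alpha> T" using T by (auto simp: bergman_normal_def)
  have "conj_J (conj_J f) = f" for f by (simp add: conj_J_def)
  thus "bergman_C_symmetric \<alpha> conj_J T"
    using T by (auto simp: bergman_C_symmetric_def bergman_conjugation_conj_J adj J)
qed

text \<open>Each monomial is an eigenvector, so the operator bound applied to it bounds the modulus
  of its eigenvalue.\<close>

lemma bergman_bounded_diagonal_bound:
  assumes \<alpha>: "\<alpha> > -1" and T: "bergman_bounded \<alpha> T"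
    and diag: "\<And>f j. f \<in> bergman_space \<alpha> \<Longrightarrow> taylor_coeff (T f) j = \<mu> j * taylor_coeff f j"
  shows "\<exists>K. \<forall>j. cmod (\<mu> j) \<le> K"
proof -
  obtain K where K: "\<And>f. f \<in> bergman_space \<alpha> \<Longrightarrow> bergman_norm \<alpha> (T f) \<le> K * bergman_norm \<alpha> f"
    using T unfolding bergman_bounded_def by blast
  have "cmod (\<mu> j) \<le> K" for j
  proof -
    let ?e = "bergman_monomial j"
    have w: "bergman_weight \<alpha> j > 0" by (rule bergman_weight_pos[OF \<alpha>])
    have "bergman_norm \<alpha> (T ?e) = sqrt ((cmod (\<mu> j))\<^sup>2 * bergman_weight \<alpha> j)"
      unfolding bergman_norm_def diag[OF bergman_monomial_in_space] taylor_coeff_bergman_monomial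
      by (subst suminf_finite[of "{j}"]) auto
    moreover have "bergman_norm \<alpha> ?e = sqrt (bergman_weight \<alpha> j)"
      unfolding bergman_norm_def taylor_coeff_bergman_monomial
      by (subst suminf_finite[of "{j}"]) auto
    ultimately show ?thesis
      using K[OF bergman_monomial_in_space, of j] w by (simp add: real_sqrt_mult)
  qed
  thus ?thesis by blast
qed

section \<open>Normality of weighted composition-differentiation operators fixing the origin\<close>

theorem proposition3p2:
  fixes \<alpha> :: real and n :: nat and \<psi> \<phi> :: "complex \<Rightarrow> complex"
  assumes "\<alpha> > -1"
    and "n > 0"
    and "\<psi> holomorphic_on unit_disk"
    and "\<exists>z\<in>unit_disk. \<psi> z \<noteq> 0"
    and "\<phi> holomorphic_on unit_disk"
    and "\<phi> ` unit_disk \<subseteq> unit_disk"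
    and "\<not> \<phi> constant_on unit_disk"
    and "bergman_bounded \<alpha> (weighted_comp_diff \<psi> \<phi> n)"
    and "\<phi> 0 = 0"
  shows "(bergman_normal \<alpha> (weighted_comp_diff \<psi> \<phi> n) \<longleftrightarrow>
           (\<exists>a b. a \<noteq> 0 \<and> b \<in> unit_disk - {0} \<and>
              (\<forall>z\<in>unit_disk. \<psi> z = a * z ^ n \<and> \<phi> z = b * z))) \<and>
         (bergman_normal \<alpha> (weighted_comp_diff \<psi> \<phi> n) \<longrightarrow>
           bergman_C_symmetric \<alpha> conj_J (weighted_comp_diff \<psi> \<phi> n))"
proof -
  define T where "T = weighted_comp_diff \<psi> \<phi> n"
  have T: "bergman_bounded \<alpha> T" using assms(8) by (simp add: T_def)
  have T_mono: "T (bergman_monomial m) z = \<psi> z * (pochhammer (of_nat (Suc m - n)) n * \<phi> z ^ (m - n))"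
    if "z \<in> unit_disk" for m z
    unfolding T_def by (rule weighted_comp_diff_monomial[OF assms(6) that])
  have T_coeff: "taylor_coeff (T f) j = (\<Sum>i=0..j. taylor_coeff \<psi> i *
      fps_nth (fps_compose (fps_expansion ((deriv ^^ n) f) 0) (fps_expansion \<phi> 0)) (j - i))"
    if "f \<in> bergman_space \<alpha>" for f j
    unfolding T_def fps_expansion_weighted_comp_diff[OF assms(3,5,9) bergman_spaceD(1)[OF that]] fps_mult_nth ..

  \<comment> \<open>Serves both directions: normality and symmetry for the converse, and
    \<open>cmod b < 1\<close> for the forward implication. The self-map property alone would still
    allow \<open>cmod b = 1\<close>; boundedness of the operator excludes it.\<close>
  have diag: "bergman_normal \<alpha> T \<and> bergman_C_symmetric \<alpha> conj_J T \<and> (a \<noteq> 0 \<longrightarrow> cmod b < 1)"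
    if ab: "\<And>z. z \<in> unit_disk \<Longrightarrow> \<psi> z = a * z ^ n" "\<And>z. z \<in> unit_disk \<Longrightarrow> \<phi> z = b * z" for a b
  proof -
    define \<mu> where "\<mu> = (\<lambda>j. if j < n then 0 else a * b ^ (j - n) * (fact j / fact (j - n)))"
    have \<mu>: "taylor_coeff (T f) j = \<mu> j * taylor_coeff f j" if "f \<in> bergman_space \<alpha>" for f j
      unfolding T_def \<mu>_def
      by (rule taylor_coeff_weighted_comp_diff_diagonal[OF ab bergman_spaceD(1)[OF that]])
    obtain K where K: "\<And>j. cmod (\<mu> j) \<le> K"
      using bergman_bounded_diagonal_bound[OF assms(1) T \<mu>] by blast
    have "cmod b < 1" if a: "a \<noteq> 0"
    proof (rule ccontr)
      assume "\<not> cmod b < 1"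
      hence b: "1 \<le> cmod b" by simp
      \<comment> \<open>If \<open>cmod b\<close> is at least 1, the eigenvalue of index
        \<open>k + n\<close> has modulus at least \<open>cmod a * (k + n)! / k!\<close>, and this
        grows at least linearly in \<open>k\<close> because \<open>n\<close> is positive.\<close>
      have le: "cmod a * real k \<le> K" for k
      proof -
        have "real k * fact k \<le> (fact (Suc k) :: real)" by simp
        also have "\<dots> \<le> fact (k + n)" using assms(2) by (intro fact_mono) auto
        finally have "real k \<le> fact (k + n) / fact k" by (simp add: field_simps)
        also have "\<dots> \<le> cmod b ^ k * (fact (k + n) / fact k)"
          using mult_right_mono[OF one_le_power[OF b], of "fact (k + n) / fact k" k] by simp
        finally have "cmod a * real k \<le> cmod a * (cmod b ^ k * (fact (k + n) / fact k))"
          by (intro mult_left_mono) auto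
        also have "\<dots> = cmod (\<mu> (k + n))"
          by (simp add: \<mu>_def norm_mult norm_divide norm_power)
        also have "\<dots> \<le> K" by (rule K)
        finally show ?thesis .
      qed
      obtain k where "K / cmod a < real k" using reals_Archimedean2 by blast
      hence "K < cmod a * real k" using a by (simp add: field_simps)
      thus False using le[of k] by simp
    qed
    thus ?thesis
      using bergman_normal_diagonal[OF assms(1) T \<mu>] bergman_C_symmetric_diagonal[OF assms(1) T \<mu>] by auto
  qed

  have forward: "\<exists>a b. a \<noteq> 0 \<and> b \<in> unit_disk - {0} \<and> (\<forall>z\<in>unit_disk. \<psi> z = a * z ^ n \<and> \<phi> z = b * z)"
    if normal: "bergman_normal \<alpha> T"
  proof -
    define a where "a = taylor_coeff \<psi> n"
    \<comment> \<open>A monomial of degree \<open>j < n\<close> is killed by the derivative, so the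
      range of \<open>T\<close> is orthogonal to it. The element
      \<open>T (bergman_monomial n)\<close> of the range is \<open>fact n * \<psi> z\<close> on the
      disk.\<close>
    have psi_low: "taylor_coeff \<psi> j = 0" if "j < n" for j
    proof -
      have "T (bergman_monomial j) z = 0" for z
      proof (cases "z \<in> unit_disk")
        case True
        thus ?thesis using T_mono[OF True, of j] that assms(2) by (simp add: pochhammer_0_left)
      next
        case False
        thus ?thesis by (simp add: T_def weighted_comp_diff_def)
      qed
      hence "bergman_inner \<alpha> (T (bergman_monomial n)) (bergman_monomial j) = 0"
        by (intro bergman_normal_kernel[OF assms(1) normal] bergman_monomial_in_space) auto
      hence "taylor_coeff (T (bergman_monomial n)) j = 0"
        using bergman_weight_pos[OF assms(1), of j] by (simp add: bergman_inner_monomial_right)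
      also have "taylor_coeff (T (bergman_monomial n)) j = taylor_coeff (\<lambda>z. fact n * \<psi> z) j"
        by (rule taylor_coeff_cong) (simp add: T_mono pochhammer_fact)
      also have "\<dots> = fact n * taylor_coeff \<psi> j"
        by (rule taylor_coeff_cmult[OF assms(3)])
      finally show ?thesis by simp
    qed
    \<comment> \<open>In the Cauchy product only \<open>i = n\<close> survives, since
      \<open>\<psi>\<close> has no lower coefficients. Its other factor is the constant coefficient
      of the composition, \<open>fact n * taylor_coeff f n\<close>.\<close>
    have "taylor_coeff (T f) n = a * fact n * taylor_coeff f n" if f: "f \<in> bergman_space \<alpha>" for f
      unfolding T_coeff[OF f]
      by (subst sum.remove[of _ n])
         (auto simp: psi_low a_def taylor_coeff_higher_deriv intro!: sum.neutral)
    from bergman_normal_eigen_monomial[OF assms(1) normal this]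
    have "T (bergman_monomial n) z = a * fact n * bergman_monomial n z" for z by simp
    hence psi: "\<psi> z = a * z ^ n" if "z \<in> unit_disk" for z
      using that T_mono[OF that, of n] by (simp add: bergman_monomial_def flip: pochhammer_fact)
    have a0: "a \<noteq> 0" using assms(4) psi by auto
    have psi_coeff: "taylor_coeff \<psi> j = (if j = n then a else 0)" for j
      using taylor_coeff_cong[OF psi] taylor_coeff_cmult[of "\<lambda>z. z ^ n" a j] taylor_coeff_power[of n j]
      by (simp add: holomorphic_intros)
    \<comment> \<open>With \<open>\<psi>\<close> now equal to \<open>a * z ^ n\<close>, the
      coefficient of index \<open>Suc n\<close> in the image is \<open>a\<close> times the linear
      coefficient of the composition, to which only the linear coefficients of the
      \<open>n\<close>-th derivative and of \<open>\<phi>\<close> contribute.\<close>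
    define \<mu> where "\<mu> = a * fact (Suc n) * taylor_coeff \<phi> 1"
    have "taylor_coeff (T f) (Suc n) = \<mu> * taylor_coeff f (Suc n)" if f: "f \<in> bergman_space \<alpha>" for f
      unfolding T_coeff[OF f]
      by (subst sum.remove[of _ n])
         (auto simp: psi_coeff fps_compose_nth taylor_coeff_higher_deriv \<mu>_def mult_ac)
    from bergman_normal_eigen_monomial[OF assms(1) normal this]
    have Tn: "T (bergman_monomial (Suc n)) z = \<mu> * bergman_monomial (Suc n) z" for z by simp
    \<comment> \<open>The factor from differentiating \<open>z ^ Suc n\<close>, with starting value
      \<open>Suc (Suc n) - n = 2\<close>. It equals \<open>(n + 1)!\<close>, so \<open>b\<close>
      below is the derivative of \<open>\<phi>\<close> at 0.\<close>
    define p where "p = (pochhammer 2 n :: complex)"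
    have p0: "p \<noteq> 0" unfolding p_def
      using pochhammer_of_nat[of 2 n, where 'a = complex] pochhammer_pos[of "2 :: nat" n] by simp
    define b where "b = \<mu> / (a * p)"
    have phi: "\<phi> z = b * z" if z: "z \<in> unit_disk" for z
    \<comment> \<open>Away from 0 the two expressions for
      \<open>T (bergman_monomial (Suc n)) z\<close> are divided by \<open>a * p * z ^ n\<close>; at
      0 the claim is \<open>\<phi> 0 = 0\<close>.\<close>
    proof (cases "z = 0")
      case False
      have "a * z ^ n * (p * \<phi> z) = \<mu> * z ^ Suc n"
        using Tn[of z] T_mono[OF z, of "Suc n"] z psi[OF z]
        by (auto simp: bergman_monomial_def p_def)
      thus ?thesis using False a0 p0 by (simp add: b_def field_simps)
    qed (use assms(9) in simp)
    have "b \<noteq> 0"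
      using assms(7) phi by (auto simp: constant_on_def)
    moreover have "cmod b < 1" using diag[OF psi phi] a0 by simp
    ultimately show ?thesis using a0 psi phi by auto
  qed
  show ?thesis
    unfolding T_def[symmetric]
  proof (intro conjI iffI impI)
    assume normal: "bergman_normal \<alpha> T"
    show "\<exists>a b. a \<noteq> 0 \<and> b \<in> unit_disk - {0} \<and> (\<forall>z\<in>unit_disk. \<psi> z = a * z ^ n \<and> \<phi> z = b * z)"
      by (rule forward[OF normal])
    then obtain a b where "\<And>z. z \<in> unit_disk \<Longrightarrow> \<psi> z = a * z ^ n" "\<And>z. z \<in> unit_disk \<Longrightarrow> \<phi> z = b * z"
      by blast
    thus "bergman_C_symmetric \<alpha> conj_J T" using diag by blast
  next
    assume "\<exists>a b. a \<noteq> 0 \<and> b \<in> unit_disk - {0} \<and> (\<forall>z\<in>unit_disk. \<psi> z = a * z ^ n \<and> \<phi> z = b * z)"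
    then obtain a b where "\<And>z. z \<in> unit_disk \<Longrightarrow> \<psi> z = a * z ^ n" "\<And>z. z \<in> unit_disk \<Longrightarrow> \<phi> z = b * z"
      by blast
    thus "bergman_normal \<alpha> T" using diag by blast
  qed
qed

end
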